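(* Let $G$ be a finite graph and $A$ a vertex of $G$. The sages win the hat guessing game on $G$ with the hint $A^*$ if and only if they win the hat guessing game on $G$ without hints.
   Context: Hat guessing game: a sage sits at each vertex of a finite graph; hat colors are $H=\{0,1,2\}$; each sage sees only his neighbours' hats and guesses his own color by a deterministic function of the neighbours' colors, fixed in advance; without hints, a strategy is winning if every hat placement has at least one correct guess. Hint $A^*$: sage $A$ gets a hat of one of only two colors, and the excluded color becomes known to $A$ alone at the moment he puts on his hat. Formally, the sages fix a function $f_v$ for each $v\ne A$, and three functions $f_A^{(0)},f_A^{(1)},f_A^{(2)}$ of the neighbours' colors for $A$; the adversary chooses an excluded color $j\in H$ and a placement $C$ with $C(A)\ne j$, and $A$ guesses using $f_A^{(j)}$. The sages win with the hint $A^*$ if they can choose these functions so that for every $j$ and every placement $C$ with $C(A)\neq j$ at least one sage guesses correctly. *)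

theory Defs
  imports "Graph_Theory.Digraph" "HOL-Library.FuncSet"
begin

text \<open>A finite simple undirected graph is a digraph satisfying the locale predicate
  \<^const>\<open>graph\<close>: finite, without loops and parallel arcs, and with a symmetric
  adjacency relation.\<close>

definition hat_colors :: "nat set" where
  "hat_colors = {0, 1, 2}"

definition neighbours :: "('a, 'b) pre_digraph \<Rightarrow> 'a \<Rightarrow> 'a set" where
  "neighbours G v = {u \<in> verts G. v \<rightarrow>\<^bsub>G\<^esub> u}"

definition placements :: "('a, 'b) pre_digraph \<Rightarrow> ('a \<Rightarrow> nat) set" where
  "placements G = verts G \<rightarrow>\<^sub>E hat_colors"

definition guess_functions :: "('a, 'b) pre_digraph \<Rightarrow> 'a \<Rightarrow> (('a \<Rightarrow> nat) \<Rightarrow> nat) set" where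
  "guess_functions G v = (neighbours G v \<rightarrow>\<^sub>E hat_colors) \<rightarrow> hat_colors"

definition guesses_correctly ::
    "('a, 'b) pre_digraph \<Rightarrow> (('a \<Rightarrow> nat) \<Rightarrow> nat) \<Rightarrow> ('a \<Rightarrow> nat) \<Rightarrow> 'a \<Rightarrow> bool" where
  "guesses_correctly G g C v \<longleftrightarrow> g (restrict C (neighbours G v)) = C v"

definition sages_win :: "('a, 'b) pre_digraph \<Rightarrow> bool" where
  "sages_win G \<longleftrightarrow>
     (\<exists>f \<in> (\<Pi> v\<in>verts G. guess_functions G v).
        \<forall>C \<in> placements G. \<exists>v \<in> verts G. guesses_correctly G (f v) C v)"

text \<open>The excluded colour \<^term>\<open>j\<close> is known to sage \<^term>\<open>A\<close> alone, hence only his guessing function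
  \<^term>\<open>fA j\<close> depends on it.\<close>

definition sages_win_hint :: "('a, 'b) pre_digraph \<Rightarrow> 'a \<Rightarrow> bool" where
  "sages_win_hint G A \<longleftrightarrow>
     (\<exists>f \<in> (\<Pi> v\<in>verts G - {A}. guess_functions G v).
      \<exists>fA \<in> hat_colors \<rightarrow> guess_functions G A.
        \<forall>j \<in> hat_colors. \<forall>C \<in> placements G. C A \<noteq> j \<longrightarrow>
          guesses_correctly G (fA j) C A \<or>
          (\<exists>v \<in> verts G - {A}. guesses_correctly G (f v) C v))"

end

theory Submission
  imports Defs
begin

text \<open>Fix the functions of the sages other than \<open>A\<close>, and call a placement critical if none of them
  guesses correctly. Two critical placements that look the same to \<open>A\<close> give \<open>A\<close> the same colour:
  otherwise the third colour, when excluded, is compatible with both, and one value of \<open>f\<^sub>A\<close> would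
  have to equal two different colours. So without any hint \<open>A\<close> can guess the colour that he has in
  the critical placements consistent with what he sees.\<close>

text \<open>Three colours are not exhausted by two values, equal or not; this supplies an excluded
  colour compatible with two placements at once.\<close>

lemma hat_colors_avoid_two: "\<exists>j\<in>hat_colors. j \<noteq> a \<and> j \<noteq> b"
proof -
  have "card {a, b} < card hat_colors"
    by (simp add: hat_colors_def card_insert_if)
  then have "\<not> hat_colors \<subseteq> {a, b}"
    using card_mono[of "{a, b}" hat_colors] by auto
  then show ?thesis by blast
qed

text \<open>\<open>A\<close> may ignore the hint and use \<open>f A\<close> for every excluded
  colour.\<close>

lemma sages_win_imp_sages_win_hint:
  assumes "A \<in> verts G" and "sages_win G"
  shows "sages_win_hint G A"
proof -
  obtain f where f: "f \<in> (\<Pi> v\<in>verts G. guess_functions G v)"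
    and win: "\<forall>C\<in>placements G. \<exists>v\<in>verts G. guesses_correctly G (f v) C v"
    using assms(2) unfolding sages_win_def by blast
  show ?thesis
    unfolding sages_win_hint_def
  proof (intro bexI[of _ f] bexI[of _ "\<lambda>_. f A"] ballI impI)
    fix C assume "C \<in> placements G"
    then show "guesses_correctly G (f A) C A \<or>
        (\<exists>v\<in>verts G - {A}. guesses_correctly G (f v) C v)"
      using win by blast
  qed (use f assms(1) in \<open>simp_all add: Pi_iff\<close>)
qed

lemma sages_win_hint_imp_sages_win:
  assumes "A \<in> verts G" and "sages_win_hint G A"
  shows "sages_win G"
proof -
  obtain f fA where f: "f \<in> (\<Pi> v\<in>verts G - {A}. guess_functions G v)"
    and win: "\<And>j C. \<lbrakk>j \<in> hat_colors; C \<in> placements G; C A \<noteq> j\<rbrakk> \<Longrightarrow>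
          guesses_correctly G (fA j) C A \<or> (\<exists>v\<in>verts G - {A}. guesses_correctly G (f v) C v)"
    using assms(2) unfolding sages_win_hint_def by blast
  define critical where "critical =
    {C \<in> placements G. \<forall>v\<in>verts G - {A}. \<not> guesses_correctly G (f v) C v}"
  define view where "view C = restrict C (neighbours G A)" for C :: "'a \<Rightarrow> nat"
  have same_colour: "C A = D A" if "C \<in> critical" "D \<in> critical" "view C = view D" for C D
  proof -
    obtain j where j: "j \<in> hat_colors" "j \<noteq> C A" "j \<noteq> D A"
      using hat_colors_avoid_two by blast
    have "fA j (view C) = C A" "fA j (view D) = D A"
      using win[of j C] win[of j D] j that(1,2)
      by (auto simp: critical_def view_def guesses_correctly_def)
    then show ?thesis using that(3) by simp
  qed
  \<comment> \<open>\<open>A\<close> reads his colour off an arbitrary critical placement that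
    matches his view. The default 0 only has to be a hat colour: in a placement whose view matches
    no critical one, another sage is right.\<close>
  define g where "g x = (if \<exists>C\<in>critical. view C = x
    then (SOME C. C \<in> critical \<and> view C = x) A else 0)" for x
  have g_critical: "\<exists>D\<in>critical. view D = view C \<and> g (view C) = D A" if "C \<in> critical" for C
    using someI[of "\<lambda>D. D \<in> critical \<and> view D = view C" C] that unfolding g_def by auto
  have colour: "C A \<in> hat_colors" if "C \<in> critical" for C
    using that assms(1) by (auto simp: critical_def placements_def)
  have "g x \<in> hat_colors" for x
  proof (cases "\<exists>C\<in>critical. view C = x")
    case True
    then show ?thesis using g_critical colour by metis
  next
    case False
    then show ?thesis by (simp add: g_def hat_colors_def)
  qed
  then have "g \<in> guess_functions G A"
    by (simp add: guess_functions_def)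
  with f have "f(A := g) \<in> (\<Pi> v\<in>verts G. guess_functions G v)"
    by (simp add: Pi_iff)
  moreover have "\<exists>v\<in>verts G. guesses_correctly G ((f(A := g)) v) C v"
    if C: "C \<in> placements G" for C
  proof (cases "C \<in> critical")
    case True
    then obtain D where D: "D \<in> critical" "view D = view C" "g (view C) = D A"
      using g_critical by blast
    \<comment> \<open>The chosen \<open>D\<close> may differ from \<open>C\<close>, but
      \<open>same_colour\<close> makes them agree at \<open>A\<close>.\<close>
    then have "g (view C) = C A"
      using same_colour[OF D(1) True D(2)] by simp
    then have "guesses_correctly G ((f(A := g)) A) C A"
      by (simp add: guesses_correctly_def view_def)
    then show ?thesis
      using assms(1) by blast
  next
    case False
    then obtain v where "v \<in> verts G - {A}" "guesses_correctly G (f v) C v"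
      using C unfolding critical_def by blast
    \<comment> \<open>Since \<open>v\<close> is not \<open>A\<close>, the update leaves his function
      unchanged.\<close>
    then have "v \<in> verts G" "guesses_correctly G ((f(A := g)) v) C v"
      by simp_all
    then show ?thesis by blast
  qed
  ultimately show ?thesis unfolding sages_win_def by blast
qed

theorem theorem16:
  fixes G :: "('a, 'b) pre_digraph" and A :: 'a
  assumes "graph G" and "A \<in> verts G"
  shows "sages_win_hint G A \<longleftrightarrow> sages_win G"
  using sages_win_hint_imp_sages_win[OF assms(2)] sages_win_imp_sages_win_hint[OF assms(2)]
  by (rule iffI)

end
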